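(* Let $\varphi(q)=\sum_{n=-\infty}^{\infty}q^{n^2}$. For all integers $n\ge 1$, $$\sum_{k=0}^{n}\overline{\sigma_o\mathrm{mex}}(k)\cdot\overline{p}_{\ge 2}(n-k)\equiv 0\pmod 4$$ and $$\sum_{k=0}^{n}\overline{\sigma_o\mathrm{mex}}(k)\cdot[q^{n-k}]\varphi(q)\equiv 2\pmod 4.$$
   Context: An overpartition of a nonnegative integer $n$ is a non-increasing sequence of positive integers summing to $n$ in which the first occurrence of each distinct integer may (or may not) be overlined; $\overline{\mathcal P}(n)$ denotes the set of all overpartitions of $n$ (the only overpartition of $0$ is the empty one). $\overline{p}_{\ge2}(n)$ denotes the number of overpartitions of $n$ with all parts at least $2$ (so $\overline{p}_{\ge2}(0)=1$). For an overpartition $\lambda$, $\mathrm{mex}(\lambda)$ is the least positive integer that does not occur as a part of $\lambda$, where a value counts as occurring whether it appears overlined or non-overlined. Put $\mathrm{mex}_o(\lambda)=\mathrm{mex}(\lambda)$ if $\mathrm{mex}(\lambda)$ is odd and $\mathrm{mex}_o(\lambda)=0$ otherwise. Define $\overline{\sigma_o\mathrm{mex}}(n)=\sum_{\lambda\in\overline{\mathcal P}(n)}\mathrm{mex}_o(\lambda)$ for $n\ge 0$. Notation: $[q^m]A(q)$ is the coefficient of $q^m$ in the power series $A(q)$. *)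

theory Defs
  imports "HOL-Analysis.Analysis" "HOL-Number_Theory.Cong"
begin

text \<open>An overpartition is the list of its parts in non-increasing order, each part
  paired with a flag that tells whether this occurrence is overlined.\<close>

definition overpartition :: "nat \<Rightarrow> (nat \<times> bool) list \<Rightarrow> bool" where
  "overpartition n xs \<longleftrightarrow>
     sorted_wrt (\<ge>) (map fst xs) \<and>
     (\<forall>x\<in>set xs. fst x > 0) \<and>
     sum_list (map fst xs) = n \<and>
     (\<forall>i<length xs. snd (xs ! i) \<longrightarrow> (\<forall>j<i. fst (xs ! j) \<noteq> fst (xs ! i)))"

definition overpartitions :: "nat \<Rightarrow> (nat \<times> bool) list set" where
  "overpartitions n = {xs. overpartition n xs}"

definition num_overpartitions_ge2 :: "nat \<Rightarrow> nat" where
  "num_overpartitions_ge2 n = card {xs \<in> overpartitions n. \<forall>x\<in>set xs. fst x \<ge> 2}"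

definition mex :: "(nat \<times> bool) list \<Rightarrow> nat" where
  "mex xs = (LEAST m. m > 0 \<and> m \<notin> fst ` set xs)"

definition mex_odd :: "(nat \<times> bool) list \<Rightarrow> nat" where
  "mex_odd xs = (if odd (mex xs) then mex xs else 0)"

definition sigma_odd_mex :: "nat \<Rightarrow> nat" where
  "sigma_odd_mex n = (\<Sum>xs\<in>overpartitions n. mex_odd xs)"

text \<open>The bilateral theta series, as an infinite sum in the topology of formal power series.\<close>

definition phi :: "int fps" where
  "phi = (\<Sum>\<^sub>\<infinity>n::int. fps_X ^ nat (n\<^sup>2))"


text \<open>Neither the cardinality and the sum over overpartitions nor the infinite sum takes
  a default value: the underlying sets are finite, and the series converges.\<close>

lemma finite_overpartitions: "finite (overpartitions n)"
proof (rule finite_subset)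
  show "overpartitions n \<subseteq> {xs. set xs \<subseteq> {..n} \<times> UNIV \<and> length xs \<le> n}"
  proof
    fix xs assume "xs \<in> overpartitions n"
    then have pos: "\<forall>x\<in>set xs. fst x > 0" and sm: "sum_list (map fst xs) = n"
      by (auto simp: overpartitions_def overpartition_def)
    have "length ys \<le> sum_list (map fst ys)" if "\<forall>x\<in>set ys. fst x > 0"
      for ys :: "(nat \<times> bool) list"
      using that by (induction ys) auto
    then have "length xs \<le> n" using pos sm by blast
    moreover have "fst x \<le> n" if "x \<in> set xs" for x
      using member_le_sum_list[of "fst x" "map fst xs"] that sm by auto
    ultimately show "xs \<in> {xs. set xs \<subseteq> {..n} \<times> UNIV \<and> length xs \<le> n}" by auto
  qed
  show "finite {xs :: (nat \<times> bool) list. set xs \<subseteq> {..n} \<times> UNIV \<and> length xs \<le> n}"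
    by (rule finite_lists_length_le) simp
qed

lemma finite_int_squares: "finite {k::int. k\<^sup>2 = int m}"
proof (rule finite_subset)
  show "{k::int. k\<^sup>2 = int m} \<subseteq> {- int m..int m}"
  proof
    fix k :: int assume "k \<in> {k. k\<^sup>2 = int m}"
    then have "\<bar>k\<bar> * \<bar>k\<bar> = int m" by (simp add: power2_eq_square)
    moreover have "\<bar>k\<bar> \<le> \<bar>k\<bar> * \<bar>k\<bar>"
      using mult_left_mono[of 1 "\<bar>k\<bar>" "\<bar>k\<bar>"] by (cases "k = 0") auto
    ultimately show "k \<in> {- int m..int m}" by auto
  qed
qed simp

lemma has_sum_phi_aux:
  "((\<lambda>n::int. fps_X ^ nat (n\<^sup>2)) has_sum
     (Abs_fps (\<lambda>m. int (card {k::int. k\<^sup>2 = int m})))) UNIV"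
  unfolding has_sum_def
proof (rule tendsto_fpsI)
  fix m
  let ?K = "{k::int. k\<^sup>2 = int m}"
  have "fps_nth (\<Sum>n\<in>F. fps_X ^ nat (n\<^sup>2)) m = int (card ?K)"
    if "finite F" "?K \<subseteq> F" for F :: "int set"
  proof -
    have "fps_nth (\<Sum>n\<in>F. fps_X ^ nat (n\<^sup>2)) m = (\<Sum>n\<in>F. if n \<in> ?K then 1 else (0::int))"
      unfolding fps_sum_nth by (rule sum.cong) (auto simp: fps_X_power_nth)
    also have "\<dots> = (\<Sum>n\<in>?K. 1)"
      using that by (intro sum.mono_neutral_cong_right) auto
    finally show ?thesis by simp
  qed
  then show "\<forall>\<^sub>F F in finite_subsets_at_top UNIV. fps_nth (\<Sum>n\<in>F. fps_X ^ nat (n\<^sup>2)) m =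
      fps_nth (Abs_fps (\<lambda>m. int (card {k::int. k\<^sup>2 = int m}))) m"
    unfolding eventually_finite_subsets_at_top
    using finite_int_squares[of m] by (intro exI[of _ ?K]) auto
qed

lemma has_sum_phi: "((\<lambda>n::int. fps_X ^ nat (n\<^sup>2)) has_sum phi) UNIV"
  using has_sum_phi_aux infsumI[OF has_sum_phi_aux] by (simp add: phi_def)

lemma fps_nth_phi: "fps_nth phi m = int (card {k::int. k\<^sup>2 = int m})"
  using infsumI[OF has_sum_phi_aux] by (simp add: phi_def)

end

theory Submission
  imports Defs
begin

text \<open>
  Modulo 4 both convolutions collapse to their two end terms. Each of the sequences involved
  starts with 1 and is even from then on, so that a product of two terms of positive index
  is divisible by 4; \<open>convolution_even_cong_4\<close> says what remains.

  The values modulo 4 come from one count: a partition with \<open>r\<close> distinct part sizes underlies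
  \<open>2 ^ r\<close> overpartitions (\<open>card_overlinings\<close>). Hence only partitions with at most one part size
  matter modulo 4. An odd mex that exceeds 1 forces the sizes 1 and 2 to occur, so the odd mex sum
  is congruent to the number of overpartitions without part 1, that is with mex 1
  (\<open>sigma_odd_mex_cong\<close>). The partitions of \<open>n \<ge> 1\<close> into equal parts correspond to the divisors
  \<open>d\<close> of \<open>n\<close>, and the condition on the parts excludes only \<open>d = 1\<close>; with \<open>\<tau>\<close> for the number of
  divisors, that number of overpartitions is therefore congruent to \<open>2 (\<tau> n - 1)\<close>
  (\<open>num_overpartitions_ge2_cong\<close>).

  The first convolution is thus congruent to twice an even number. In the second, pairing each
  divisor \<open>d\<close> with \<open>n / d\<close> shows that \<open>\<tau> n\<close> has the parity of the number of natural square
  roots of \<open>n\<close>, so the coefficient of \<open>\<phi>\<close> at \<open>n\<close> is congruent to \<open>2 \<tau> n\<close> modulo 4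
  (\<open>phi_coeff_cong_divisors\<close>), and the two end terms add up to
  \<open>2 (\<tau> n - 1) + 2 \<tau> n = 4 \<tau> n - 2\<close>.
\<close>

section \<open>Overpartitions as overlined partitions\<close>

definition partitions :: "nat \<Rightarrow> nat list set" where
  "partitions n = {ys. sorted_wrt (\<ge>) ys \<and> (\<forall>y\<in>set ys. y > 0) \<and> sum_list ys = n}"

definition overlinings :: "nat list \<Rightarrow> (nat \<times> bool) list set" where
  "overlinings ys = {xs. map fst xs = ys \<and>
     (\<forall>i<length xs. snd (xs ! i) \<longrightarrow> (\<forall>j<i. fst (xs ! j) \<noteq> fst (xs ! i)))}"

lemma overlinings_Nil: "overlinings [] = {[]}"
  by (auto simp: overlinings_def)

lemma snoc_in_overlinings:
  "xs @ [(y, b)] \<in> overlinings (ys @ [y]) \<longleftrightarrow> xs \<in> overlinings ys \<and> (b \<longrightarrow> y \<notin> set ys)"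
proof -
  have "(\<forall>j<length xs. fst (xs ! j) \<noteq> y) \<longleftrightarrow> y \<notin> set (map fst xs)"
    by (metis in_set_conv_nth length_map nth_map)
  then show ?thesis
    by (auto simp add: overlinings_def All_less_Suc nth_append simp del: set_map)
qed

lemma overlinings_snoc:
  "overlinings (ys @ [y]) =
     (\<lambda>xs. xs @ [(y, False)]) ` overlinings ys \<union>
     (if y \<in> set ys then {} else (\<lambda>xs. xs @ [(y, True)]) ` overlinings ys)"
    (is "?L = ?R")
proof
  show "?L \<subseteq> ?R"
  proof
    fix zs assume zs: "zs \<in> ?L"
    then have "map fst zs = ys @ [y]" by (simp add: overlinings_def)
    then obtain xs b where eq: "zs = xs @ [(y, b)]"
      by (cases zs rule: rev_cases) auto
    with zs show "zs \<in> ?R" by (cases b) (auto simp: snoc_in_overlinings)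
  qed
  show "?R \<subseteq> ?L" by (auto simp: snoc_in_overlinings)
qed

text \<open>Reading the list from the left, each entry offers a choice exactly when its value is new.\<close>

lemma card_overlinings:
  "finite (overlinings ys) \<and> card (overlinings ys) = 2 ^ card (set ys)"
proof (induction ys rule: rev_induct)
  case Nil
  then show ?case by (simp add: overlinings_Nil)
next
  case (snoc y ys)
  have c: "card ((\<lambda>xs. xs @ [(y, b)]) ` overlinings ys) = 2 ^ card (set ys)" for b
    using snoc by (subst card_image) (auto simp: inj_on_def)
  show ?case
  proof (cases "y \<in> set ys")
    case True
    then show ?thesis using snoc c[of False] by (simp add: overlinings_snoc insert_absorb)
  next
    case False
    have "card ((\<lambda>xs. xs @ [(y, False)]) ` overlinings ys \<union>
        (\<lambda>xs. xs @ [(y, True)]) ` overlinings ys) = 2 ^ card (set ys) + 2 ^ card (set ys)"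
      using snoc c by (subst card_Un_disjoint) auto
    then show ?thesis using False snoc by (simp add: overlinings_snoc)
  qed
qed

lemma overpartitions_eq:
  "overpartitions n = {xs. map fst xs \<in> partitions n \<and> xs \<in> overlinings (map fst xs)}"
  by (simp add: partitions_def overpartitions_def overpartition_def overlinings_def)

lemma overpartitions_fibre:
  assumes "ys \<in> partitions n"
  shows "{xs \<in> overpartitions n. map fst xs = ys} = overlinings ys"
proof -
  have "map fst xs = ys" if "xs \<in> overlinings ys" for xs
    using that by (simp add: overlinings_def)
  then show ?thesis using assms by (auto simp: overpartitions_eq)
qed

lemma finite_partitions: "finite (partitions n)"
proof (rule finite_subset)
  show "partitions n \<subseteq> map fst ` overpartitions n"
  proof
    fix ys assume ys: "ys \<in> partitions n"
    \<comment> \<open>Every partition has at least one overlining, since their number is a power of 2.\<close>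
    have "overlinings ys \<noteq> {}" using card_overlinings[of ys] by auto
    then obtain xs where "xs \<in> {xs \<in> overpartitions n. map fst xs = ys}"
      unfolding overpartitions_fibre[OF ys] by blast
    then show "ys \<in> map fst ` overpartitions n" by blast
  qed
qed (simp add: finite_overpartitions)

lemma sum_overpartitions:
  fixes f :: "nat list \<Rightarrow> nat"
  shows "(\<Sum>xs\<in>overpartitions n. f (map fst xs)) = (\<Sum>ys\<in>partitions n. 2 ^ card (set ys) * f ys)"
proof -
  have map_fst_in: "map fst ` overpartitions n \<subseteq> partitions n"
    by (auto simp: overpartitions_eq)
  have "(\<Sum>xs\<in>overpartitions n. f (map fst xs)) =
      (\<Sum>ys\<in>partitions n. \<Sum>xs\<in>{xs \<in> overpartitions n. map fst xs = ys}. f (map fst xs))"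
    by (rule sum.group[symmetric])
      (use map_fst_in finite_overpartitions finite_partitions in auto)
  also have "\<dots> = (\<Sum>ys\<in>partitions n. 2 ^ card (set ys) * f ys)"
  proof (rule sum.cong)
    fix ys assume ys: "ys \<in> partitions n"
    have "(\<Sum>xs\<in>overlinings ys. f (map fst xs)) = (\<Sum>xs\<in>overlinings ys. f ys)"
      by (rule sum.cong) (auto simp: overlinings_def)
    then show "(\<Sum>xs\<in>{xs \<in> overpartitions n. map fst xs = ys}. f (map fst xs)) =
        2 ^ card (set ys) * f ys"
      unfolding overpartitions_fibre[OF ys] by (simp add: card_overlinings)
  qed simp
  finally show ?thesis .
qed

lemma num_overpartitions_ge2_eq:
  "num_overpartitions_ge2 n = (\<Sum>ys\<in>partitions n. 2 ^ card (set ys) * of_bool (1 \<notin> set ys))"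
proof -
  have "{xs \<in> overpartitions n. \<forall>x\<in>set xs. fst x \<ge> 2} =
      {xs \<in> overpartitions n. 1 \<notin> set (map fst xs)}"
  proof (intro Collect_cong conj_cong refl)
    fix xs assume "xs \<in> overpartitions n"
    then have "\<forall>x\<in>set xs. fst x > 0" by (simp add: overpartitions_def overpartition_def)
    then have "\<forall>x\<in>set xs. 2 \<le> fst x \<longleftrightarrow> fst x \<noteq> 1"
      by (metis One_nat_def Suc_1 Suc_leI le_neq_implies_less not_less_eq_eq)
    then show "(\<forall>x\<in>set xs. 2 \<le> fst x) \<longleftrightarrow> 1 \<notin> set (map fst xs)"
      by (metis imageE imageI set_map)
  qed
  then have "num_overpartitions_ge2 n = (\<Sum>xs\<in>overpartitions n. of_bool (1 \<notin> set (map fst xs)))"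
    by (simp add: num_overpartitions_ge2_def finite_overpartitions sum_of_bool_eq Collect_conj_eq
        del: set_map)
  then show ?thesis using sum_overpartitions[of "\<lambda>ys. of_bool (1 \<notin> set ys)" n] by simp
qed

section \<open>The two counts modulo 4\<close>

definition partition_mex_odd :: "nat list \<Rightarrow> nat" where
  "partition_mex_odd ys =
     (let m = (LEAST m. m > 0 \<and> m \<notin> set ys) in if odd m then m else 0)"

lemma mex_odd_eq: "mex_odd xs = partition_mex_odd (map fst xs)"
  by (simp add: mex_odd_def mex_def partition_mex_odd_def Let_def)

lemma partition_mex_odd_no_1: "1 \<notin> set ys \<Longrightarrow> partition_mex_odd ys = 1"
proof -
  assume "1 \<notin> set ys"
  then have "(LEAST m. m > 0 \<and> m \<notin> set ys) = 1" by (intro Least_equality) auto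
  then show ?thesis by (simp add: partition_mex_odd_def)
qed

lemma partition_mex_odd_no_2:
  assumes "1 \<in> set ys" "2 \<notin> set ys"
  shows "partition_mex_odd ys = 0"
proof -
  have "(LEAST m. m > 0 \<and> m \<notin> set ys) = 2"
  proof (rule Least_equality)
    fix m assume m: "m > 0 \<and> m \<notin> set ys"
    then have "m \<noteq> 1" using assms by auto
    then show "2 \<le> m" using m by linarith
  qed (use assms in auto)
  then show ?thesis by (simp add: partition_mex_odd_def)
qed

lemma four_dvd_power_2: "c \<ge> 2 \<Longrightarrow> (4::nat) dvd 2 ^ c"
  using le_imp_power_dvd[of 2 c "2::nat"] by simp

text \<open>The mex is 1 when 1 does not occur, and 2, with weight 0, when 1 occurs without 2. If both
  occur there are at least two part sizes, and the number of overlinings is a multiple of 4.\<close>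

lemma sigma_odd_mex_cong: "[sigma_odd_mex n = num_overpartitions_ge2 n] (mod 4)"
proof -
  have "sigma_odd_mex n = (\<Sum>ys\<in>partitions n. 2 ^ card (set ys) * partition_mex_odd ys)"
    by (simp add: sigma_odd_mex_def mex_odd_eq sum_overpartitions)
  also have "[\<dots> = (\<Sum>ys\<in>partitions n. 2 ^ card (set ys) * of_bool (1 \<notin> set ys))] (mod 4)"
  proof (rule cong_sum)
    fix ys assume "ys \<in> partitions n"
    show "[2 ^ card (set ys) * partition_mex_odd ys =
        2 ^ card (set ys) * of_bool (1 \<notin> set ys)] (mod 4)"
    proof (cases "1 \<in> set ys \<and> 2 \<in> set ys")
      case True
      then have "card {1::nat, 2} \<le> card (set ys)" by (intro card_mono) auto
      then show ?thesis using True four_dvd_power_2[of "card (set ys)"]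
        by (simp add: cong_0_iff)
    next
      case False
      then show ?thesis
        using partition_mex_odd_no_1[of ys] partition_mex_odd_no_2[of ys]
        by (cases "1 \<in> set ys") auto
    qed
  qed
  finally show ?thesis by (simp only: num_overpartitions_ge2_eq)
qed

text \<open>Equal parts of size \<open>d\<close> can make up \<open>n\<close> exactly when \<open>d\<close> divides \<open>n\<close>, and then \<open>d\<close>
  determines their number. The subtracted 1 is the divisor 1, that is the partition into ones.\<close>

lemma card_equal_part_partitions_ge2:
  assumes "n \<ge> 1"
  shows "card {ys \<in> partitions n. card (set ys) = 1 \<and> 1 \<notin> set ys} = card {d. d dvd n} - 1"
proof -
  have "bij_betw (\<lambda>d. replicate (n div d) d) ({d. d dvd n} - {1})
      {ys \<in> partitions n. card (set ys) = 1 \<and> 1 \<notin> set ys}"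
  proof (rule bij_betwI[where g = hd])
    show "(\<lambda>d. replicate (n div d) d) \<in> {d. d dvd n} - {1} \<rightarrow>
        {ys \<in> partitions n. card (set ys) = 1 \<and> 1 \<notin> set ys}"
    proof
      fix d assume d: "d \<in> {d. d dvd n} - {1}"
      then have "d > 0" "n div d > 0" using assms by (auto intro!: Nat.gr0I)
      then show "replicate (n div d) d \<in> {ys \<in> partitions n. card (set ys) = 1 \<and> 1 \<notin> set ys}"
        using d by (auto simp: partitions_def sum_list_replicate sorted_wrt_iff_nth_less)
    qed
    have *: "hd ys dvd n \<and> hd ys \<noteq> 1 \<and> replicate (n div hd ys) (hd ys) = ys"
      if ys: "ys \<in> partitions n" "card (set ys) = 1" "1 \<notin> set ys" for ys
    proof -
      obtain d where d: "set ys = {d}" using ys(2) card_1_singletonE by blast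
      then have "ys \<noteq> []" by auto
      then have hd: "hd ys = d" using d hd_in_set[of ys] by auto
      have rep: "ys = replicate (length ys) d"
        using d by (metis replicate_length_same singletonD)
      have "n = sum_list ys" "d > 0" using ys(1) d by (auto simp: partitions_def)
      then have "n = length ys * d" using rep by (metis sum_list_replicate of_nat_id)
      with \<open>d > 0\<close> have "d dvd n" "n div d = length ys" by auto
      then show ?thesis using hd rep d ys(3) by auto
    qed
    then show "hd \<in> {ys \<in> partitions n. card (set ys) = 1 \<and> 1 \<notin> set ys} \<rightarrow> {d. d dvd n} - {1}"
      by auto
    fix ys assume "ys \<in> {ys \<in> partitions n. card (set ys) = 1 \<and> 1 \<notin> set ys}"
    then show "replicate (n div hd ys) (hd ys) = ys" using * by auto
  next
    fix d assume "d \<in> {d. d dvd n} - {1}"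
    then have "n div d > 0" using assms by (auto intro!: Nat.gr0I)
    then show "hd (replicate (n div d) d) = d" by simp
  qed
  then have "card {ys \<in> partitions n. card (set ys) = 1 \<and> 1 \<notin> set ys} = card ({d. d dvd n} - {1})"
    by (simp add: bij_betw_same_card)
  then show ?thesis by (simp add: card_Diff_singleton)
qed

text \<open>As \<open>n \<ge> 1\<close> rules out the empty partition, the partitions with a single part size contribute
  2 each and all others a multiple of 4.\<close>

lemma num_overpartitions_ge2_cong:
  assumes "n \<ge> 1"
  shows "[num_overpartitions_ge2 n = 2 * (card {d. d dvd n} - 1)] (mod 4)"
proof -
  have "[num_overpartitions_ge2 n =
      (\<Sum>ys\<in>partitions n. 2 * of_bool (card (set ys) = 1 \<and> 1 \<notin> set ys))] (mod 4)"
    unfolding num_overpartitions_ge2_eq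
  proof (rule cong_sum)
    fix ys assume "ys \<in> partitions n"
    then have "ys \<noteq> []" using assms by (auto simp: partitions_def)
    then have "card (set ys) \<noteq> 0" by simp
    then consider "card (set ys) = 1" | "card (set ys) \<ge> 2" by linarith
    then show "[2 ^ card (set ys) * of_bool (1 \<notin> set ys) =
        (2::nat) * of_bool (card (set ys) = 1 \<and> 1 \<notin> set ys)] (mod 4)"
      by cases (auto simp: cong_0_iff four_dvd_power_2)
  qed
  also have "(\<Sum>ys\<in>partitions n. 2 * of_bool (card (set ys) = 1 \<and> 1 \<notin> set ys)) =
      2 * card {ys \<in> partitions n. card (set ys) = 1 \<and> 1 \<notin> set ys}"
    by (simp add: finite_partitions Int_def flip: sum_distrib_left)
  finally show ?thesis by (simp only: card_equal_part_partitions_ge2[OF assms])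
qed

lemma partitions_0: "partitions 0 = {[]}"
proof -
  have "ys = []" if "\<forall>y\<in>set ys. y > 0" "sum_list ys = 0" for ys :: "nat list"
    using that by (cases ys) auto
  then show ?thesis by (auto simp: partitions_def)
qed

lemma num_overpartitions_ge2_0: "num_overpartitions_ge2 0 = 1"
  by (simp add: num_overpartitions_ge2_eq partitions_0)

lemma sigma_odd_mex_0: "sigma_odd_mex 0 = 1"
proof -
  have "sigma_odd_mex 0 = (\<Sum>ys\<in>partitions 0. 2 ^ card (set ys) * partition_mex_odd ys)"
    by (simp add: sigma_odd_mex_def mex_odd_eq sum_overpartitions)
  then show ?thesis by (simp add: partitions_0 partition_mex_odd_no_1)
qed

section \<open>Divisors, square roots and the theta series\<close>

text \<open>The map \<open>d \<mapsto> n / d\<close> exchanges the divisors below and above the square root of \<open>n\<close>.\<close>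

lemma card_divisors_cong_card_sqrts:
  fixes n :: nat
  assumes "n \<ge> 1"
  shows "[card {d. d dvd n} = card {d. d * d = n}] (mod 2)"
proof -
  let ?A = "{d. d dvd n \<and> d * d < n}" and ?B = "{d. d * d = n}" and ?C = "{d. d dvd n \<and> d * d > n}"
  have fin: "finite {d. d dvd n}" using assms by (simp add: finite_divisors_nat)
  have split: "{d. d dvd n} = ?A \<union> ?B \<union> ?C" by auto
  have "finite (?A \<union> ?B \<union> ?C)" using fin by (simp only: split)
  then have finA: "finite ?A" and finB: "finite ?B" and finC: "finite ?C"
    by (simp_all only: finite_Un)
  have codiv: "n div d dvd n \<and> n div (n div d) = d" if "d dvd n" for d
  proof -
    from \<open>d dvd n\<close> obtain e where e: "n = d * e" by (rule dvdE)
    then have "d > 0" "e > 0" using assms by (auto intro!: Nat.gr0I)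
    then show ?thesis using e by simp
  qed
  have less: "(n div d) * (n div d) > n" if "d dvd n" "d * d < n" for d
  proof -
    from \<open>d dvd n\<close> obtain e where e: "n = d * e" by (rule dvdE)
    then have "d > 0" "e > 0" using assms by (auto intro!: Nat.gr0I)
    then show ?thesis using that e by auto
  qed
  have greater: "(n div d) * (n div d) < n" if "d dvd n" "d * d > n" for d
  proof -
    from \<open>d dvd n\<close> obtain e where e: "n = d * e" by (rule dvdE)
    then have "d > 0" "e > 0" using assms by (auto intro!: Nat.gr0I)
    then show ?thesis using that e by auto
  qed
  have "bij_betw (\<lambda>d. n div d) ?A ?C"
    by (rule bij_betwI[where g = "\<lambda>d. n div d"]) (use codiv less greater in auto)
  then have "card ?A = card ?C" by (rule bij_betw_same_card)
  moreover have "card (?A \<union> ?B \<union> ?C) = card (?A \<union> ?B) + card ?C"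
    using finA finB finC by (intro card_Un_disjoint finite_UnI) auto
  moreover have "card (?A \<union> ?B) = card ?A + card ?B"
    using finA finB by (intro card_Un_disjoint) auto
  ultimately have "card {d. d dvd n} = card ?B + 2 * card ?A"
    by (simp only: split)
  then show ?thesis by (simp add: cong_def)
qed

text \<open>A positive \<open>n\<close> has its integer square roots in pairs of opposite sign.\<close>

lemma fps_nth_phi_pos:
  assumes "n \<ge> 1"
  shows "fps_nth phi n = 2 * int (card {d::nat. d * d = n})"
proof -
  let ?B = "{d::nat. d * d = n}"
  have eq: "{k::int. k\<^sup>2 = int n} = int ` ?B \<union> (\<lambda>d. - int d) ` ?B"
  proof
    show "{k::int. k\<^sup>2 = int n} \<subseteq> int ` ?B \<union> (\<lambda>d. - int d) ` ?B"
    proof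
      fix k :: int assume "k \<in> {k. k\<^sup>2 = int n}"
      then have "int (nat \<bar>k\<bar> * nat \<bar>k\<bar>) = int n" by (simp add: power2_eq_square)
      then have "nat \<bar>k\<bar> \<in> ?B" by (simp only: of_nat_eq_iff mem_Collect_eq)
      moreover have "k = int (nat \<bar>k\<bar>) \<or> k = - int (nat \<bar>k\<bar>)" by auto
      ultimately show "k \<in> int ` ?B \<union> (\<lambda>d. - int d) ` ?B" by blast
    qed
  qed (auto simp: power2_eq_square)
  have finB: "finite ?B"
    by (rule finite_subset[of _ "{..n}"]) (auto simp: le_square)
  have disj: "int ` ?B \<inter> (\<lambda>d. - int d) ` ?B = {}" using assms by auto
  have "card (int ` ?B \<union> (\<lambda>d. - int d) ` ?B) = card ?B + card ?B"
    using finB disj by (simp add: card_Un_disjoint card_image inj_on_def)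
  then show ?thesis by (simp add: fps_nth_phi eq)
qed

lemma phi_coeff_cong_divisors:
  assumes "n \<ge> 1"
  shows "[fps_nth phi n = 2 * int (card {d. d dvd n})] (mod 4)"
proof -
  have "[int (card {d. d dvd n}) = int (card {d. d * d = n})] (mod 2)"
    using card_divisors_cong_card_sqrts[OF assms] by (metis cong_int_iff of_nat_numeral)
  then have "[2 * int (card {d. d * d = n}) = 2 * int (card {d. d dvd n})] (mod 4)"
    unfolding cong_def by presburger
  then show ?thesis by (simp only: fps_nth_phi_pos[OF assms])
qed

section \<open>The convolutions\<close>

text \<open>Each inner term is a product of two even numbers; the outer terms have a factor 1.\<close>

lemma convolution_even_cong_4:
  fixes f g :: "nat \<Rightarrow> int"
  assumes "f 0 = 1" "g 0 = 1" "\<And>k. k \<ge> 1 \<Longrightarrow> even (f k)" "\<And>k. k \<ge> 1 \<Longrightarrow> even (g k)" "n \<ge> 1"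
  shows "[(\<Sum>k=0..n. f k * g (n - k)) = f n + g n] (mod 4)"
proof -
  have "(\<Sum>k=0..n. f k * g (n - k)) = (\<Sum>k\<in>{0, n} \<union> {0<..<n}. f k * g (n - k))"
    by (rule sum.cong) (use assms(5) in auto)
  also have "\<dots> = f n + g n + (\<Sum>k\<in>{0<..<n}. f k * g (n - k))"
    using assms(1,2,5) by (subst sum.union_disjoint) auto
  also have "[\<dots> = f n + g n + 0] (mod 4)"
  proof (intro cong_add cong_refl)
    have "4 dvd f k * g (n - k)" if "k \<in> {0<..<n}" for k
      using mult_dvd_mono[of 2 "f k" 2 "g (n - k)"] assms(3)[of k] assms(4)[of "n - k"] that by auto
    then show "[(\<Sum>k\<in>{0<..<n}. f k * g (n - k)) = 0] (mod 4)"
      unfolding cong_0_iff by (rule dvd_sum)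
  qed
  finally show ?thesis by simp
qed

theorem theorem1p5:
  fixes n :: nat
  assumes "n \<ge> 1"
  shows "[(\<Sum>k=0..n. sigma_odd_mex k * num_overpartitions_ge2 (n - k)) = 0] (mod 4) \<and>
         [(\<Sum>k=0..n. int (sigma_odd_mex k) * fps_nth phi (n - k)) = 2] (mod 4)"
proof
  define s where "s k = int (sigma_odd_mex k)" for k
  define p where "p k = int (num_overpartitions_ge2 k)" for k
  define t where "t k = int (card {d. d dvd k})" for k :: nat
  have s_p: "[s k = p k] (mod 4)" for k
    unfolding s_def p_def using sigma_odd_mex_cong[of k] by (metis cong_int_iff of_nat_numeral)
  have p_t: "[p k = 2 * (t k - 1)] (mod 4)" if "k \<ge> 1" for k
  proof -
    have "card {d. d dvd k} > 0" using that by (auto simp: card_gt_0_iff finite_divisors_nat)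
    then have "int (2 * (card {d. d dvd k} - 1)) = 2 * (t k - 1)"
      by (simp add: t_def of_nat_diff)
    moreover have "[p k = int (2 * (card {d. d dvd k} - 1))] (mod 4)"
      unfolding p_def using num_overpartitions_ge2_cong[OF that]
      by (metis cong_int_iff of_nat_numeral)
    ultimately show ?thesis by simp
  qed
  have phi_t: "[fps_nth phi k = 2 * t k] (mod 4)" if "k \<ge> 1" for k
    using phi_coeff_cong_divisors[OF that] by (simp add: t_def)
  have s0: "s 0 = 1" and p0: "p 0 = 1" and phi0: "fps_nth phi 0 = 1"
    by (simp_all add: s_def p_def sigma_odd_mex_0 num_overpartitions_ge2_0 fps_nth_phi)
  have even_p: "even (p k)" if "k \<ge> 1" for k
    using p_t[OF that] unfolding cong_def by presburger
  have even_s: "even (s k)" if "k \<ge> 1" for k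
    using even_p[OF that] s_p[of k] unfolding cong_def by presburger
  have even_phi: "even (fps_nth phi k)" if "k \<ge> 1" for k
    using phi_t[OF that] unfolding cong_def by presburger

  have "[(\<Sum>k=0..n. s k * p (n - k)) = s n + p n] (mod 4)"
    using s0 p0 even_s even_p assms by (rule convolution_even_cong_4)
  also have "[s n + p n = 0] (mod 4)"
    using s_p[of n] even_p[OF assms] unfolding cong_def by presburger
  finally have "[int (\<Sum>k=0..n. sigma_odd_mex k * num_overpartitions_ge2 (n - k)) = int 0] (mod int 4)"
    by (simp add: s_def p_def)
  then show "[(\<Sum>k=0..n. sigma_odd_mex k * num_overpartitions_ge2 (n - k)) = 0] (mod 4)"
    by (simp only: cong_int_iff)

  have "[(\<Sum>k=0..n. s k * fps_nth phi (n - k)) = s n + fps_nth phi n] (mod 4)"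
    using s0 phi0 even_s even_phi assms by (rule convolution_even_cong_4)
  also have "[s n + fps_nth phi n = 2] (mod 4)"
  proof -
    have "[s n + fps_nth phi n = 2 * (t n - 1) + 2 * t n] (mod 4)"
      using cong_trans[OF s_p p_t[OF assms]] phi_t[OF assms] by (rule cong_add)
    also have "2 * (t n - 1) + 2 * t n = 2 + (t n - 1) * 4" by simp
    also have "[\<dots> = 2] (mod 4)" by (simp only: cong_def mod_mult_self1)
    finally show ?thesis .
  qed
  finally show "[(\<Sum>k=0..n. int (sigma_odd_mex k) * fps_nth phi (n - k)) = 2] (mod 4)"
    by (simp add: s_def)
qed

end
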